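(* Let $(X,\mathcal B,P)$ be a weakly continuous discrete-time Markov process and let $A,B\in\mathcal B$ be disjoint and such that $A$ is a compact, non-simple set. If there exists a $\delta$-locally excessive function $g$ on $A$, then for any $\varepsilon\in(0,1)$ it holds that $m(A\setminus\{g<\varepsilon\delta\})<\infty$ and that, for all $x\in X$, $$0\le w(x;A,B)-w\big(x;A\setminus\{g<\varepsilon\delta\},B\big)\le\varepsilon.$$
   Context: A discrete-time Markov process is a triple $(X,\mathcal B,P)$ where $(X,\mathcal B)$ is a measurable space and $P$ is a stochastic kernel on it. It is weakly continuous if $X$ is a Borel subset of a Polish space, $\mathcal B$ is the Borel $\sigma$-algebra of $X$ (a topological state space), and $Pf$ is upper semi-continuous whenever $f\in\mathbb B$ is upper semi-continuous; here $\mathbb B$ is the space of bounded measurable functions $f:X\to\mathbb R$ with sup norm $\|\cdot\|$, and $Pf(x)=\int_X f(y)P(x,\mathrm dy)$. Let $(\mathbf x_n)_{n\ge0}$ be the process with kernel $P$, $\mathsf P_x$ its law when $\mathbf x_0=x$, and $\tau_D=\inf\{n\ge0:\mathbf x_n\in D\}$ for $D\in\mathcal B$ (with $\inf\emptyset=\infty$). The infinite-horizon reach-avoid value function is $w(x;A,B)=\mathsf P_x(\tau_B\le\tau_{A^c},\,\tau_B<\infty)$. The invariance value functions are $u_n(x;A)=\mathsf P_x(\tau_{A^c}>n)$, and $m(A)=\inf\{m\ge0:\|u_m(\cdot;A)\|<1\}$ (with $\inf\emptyset=\infty$). A set $D\in\mathcal B$ is absorbing if $P(x,D)=1$ for all $x\in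 D$. $\mathrm{l.a.s.}(A)$ is the largest absorbing subset of $A$ (it exists for every $A\in\mathcal B$). $A$ is simple if $\mathrm{l.a.s.}(A)=\emptyset$ and non-simple otherwise. For a function $g$ and constant $c$, $\{g<c\}=\{x\in X:g(x)<c\}$, and similarly for other relations. For $g\in\mathbb B$ the excessive set is $\mathcal E_g=\{x\in X: Pg(x)-g(x)\le0\}$. A non-negative continuous function $g\in\mathbb B$ is $\delta$-locally excessive on $A\in\mathcal B$, where $\delta>0$ is a real number, if $\{g=0\}=\mathrm{l.a.s.}(A)$, $\{g<\delta\}\subseteq A$ and $\{g<\delta\}\subseteq\mathcal E_g$. *)

theory Defs
  imports "HOL-Probability.Probability"
begin

text \<open>
  A triple \<open>(X, \<B>, P)\<close> is represented by a measure \<open>M\<close>, of which only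
  \<open>space M = X\<close> and \<open>sets M = \<B>\<close> are used, and a kernel \<open>P\<close>.  Functions on \<open>X\<close> are
  total functions on the type whose values outside \<open>space M\<close> are irrelevant, and all
  complements are taken relative to \<open>space M\<close>.
\<close>

definition markov_process :: "'a measure \<Rightarrow> ('a \<Rightarrow> 'a measure) \<Rightarrow> bool" where
  "markov_process M P \<longleftrightarrow> P \<in> M \<rightarrow>\<^sub>M prob_algebra M"

definition bounded_measurable :: "'a measure \<Rightarrow> ('a \<Rightarrow> real) \<Rightarrow> bool" where
  "bounded_measurable M f \<longleftrightarrow> f \<in> borel_measurable M \<and> bounded (f ` space M)"

definition sup_norm :: "'a measure \<Rightarrow> ('a \<Rightarrow> real) \<Rightarrow> real" where
  "sup_norm M f = (SUP x\<in>space M. \<bar>f x\<bar>)"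

definition kernel_op :: "('a \<Rightarrow> 'a measure) \<Rightarrow> ('a \<Rightarrow> real) \<Rightarrow> 'a \<Rightarrow> real" where
  "kernel_op P f x = (\<integral>y. f y \<partial>P x)"


subsection \<open>Weak continuity\<close>

definition upper_semicontinuous_on :: "'a::topological_space set \<Rightarrow> ('a \<Rightarrow> real) \<Rightarrow> bool" where
  "upper_semicontinuous_on S f \<longleftrightarrow> (\<forall>c. openin (top_of_set S) {x \<in> S. f x < c})"

definition topological_state_space :: "'a::polish_space measure \<Rightarrow> bool" where
  "topological_state_space M \<longleftrightarrow>
     space M \<in> sets borel \<and> sets M = sets (restrict_space borel (space M))"

definition weakly_continuous :: "'a::polish_space measure \<Rightarrow> ('a \<Rightarrow> 'a measure) \<Rightarrow> bool" where
  "weakly_continuous M P \<longleftrightarrow> topological_state_space M \<and>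
     (\<forall>f. bounded_measurable M f \<and> upper_semicontinuous_on (space M) f \<longrightarrow>
          upper_semicontinuous_on (space M) (kernel_op P f))"


subsection \<open>The law of the process and the value functions\<close>

text \<open>
  The law started at \<open>x\<close> is the Ionescu-Tulcea measure on
  \<open>PiM UNIV (\<lambda>_. M)\<close> whose coordinate \<open>0\<close> is \<open>x\<close> and whose coordinate \<open>Suc n\<close> has, given the
  coordinates up to \<open>n\<close>, the conditional law \<open>P (\<omega> n)\<close>.
\<close>

definition transition ::
    "'a measure \<Rightarrow> ('a \<Rightarrow> 'a measure) \<Rightarrow> 'a \<Rightarrow> nat \<Rightarrow> (nat \<Rightarrow> 'a) \<Rightarrow> 'a measure" where
  "transition M P x n \<omega> = (case n of 0 \<Rightarrow> return M x | Suc k \<Rightarrow> P (\<omega> k))"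

definition path_law :: "'a measure \<Rightarrow> ('a \<Rightarrow> 'a measure) \<Rightarrow> 'a \<Rightarrow> (nat \<Rightarrow> 'a) measure" where
  "path_law M P x =
     projective_family.lim UNIV (Ionescu_Tulcea.CI (transition M P x) (\<lambda>_. M)) (\<lambda>_. M)"

lemma Ionescu_Tulcea_transition:
  assumes "markov_process M P" and x: "x \<in> space M"
  shows "Ionescu_Tulcea (transition M P x) (\<lambda>_. M)"
proof (rule Ionescu_Tulcea.intro)
  have P: "P \<in> M \<rightarrow>\<^sub>M prob_algebra M"
    using assms by (simp add: markov_process_def)
  have P': "P \<in> M \<rightarrow>\<^sub>M subprob_algebra M"
    using P by (rule measurable_prob_algebraD)
  show "transition M P x i \<in> (\<Pi>\<^sub>M j\<in>{0..<i}. M) \<rightarrow>\<^sub>M subprob_algebra M" for i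
  proof (cases i)
    case 0
    then show ?thesis
      using x by (simp add: transition_def[abs_def] measurable_compose[OF _ return_measurable])
  next
    case (Suc k)
    have "(\<lambda>\<omega>. P (\<omega> k)) \<in> (\<Pi>\<^sub>M j\<in>{0..<Suc k}. M) \<rightarrow>\<^sub>M subprob_algebra M"
      using P' by measurable
    then show ?thesis
      by (simp add: Suc transition_def[abs_def])
  qed
  fix i :: nat and \<omega>
  assume \<omega>: "\<omega> \<in> space (\<Pi>\<^sub>M j\<in>{0..<i}. M)"
  show "prob_space (transition M P x i \<omega>)"
  proof (cases i)
    case 0
    then show ?thesis
      using x by (simp add: transition_def prob_space_return)
  next
    case (Suc k)
    with \<omega> have "\<omega> k \<in> space M"
      by (auto simp: space_PiM)
    then show ?thesis
      using measurable_space[OF P] by (auto simp: Suc transition_def space_prob_algebra)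
  qed
qed

definition hitting_time :: "'a set \<Rightarrow> (nat \<Rightarrow> 'a) \<Rightarrow> enat" where
  "hitting_time D \<omega> = Inf (enat ` {n. \<omega> n \<in> D})"

definition reach_avoid ::
    "'a measure \<Rightarrow> ('a \<Rightarrow> 'a measure) \<Rightarrow> 'a \<Rightarrow> 'a set \<Rightarrow> 'a set \<Rightarrow> real" where
  "reach_avoid M P x A B =
     measure (path_law M P x)
       {\<omega> \<in> space (path_law M P x).
          hitting_time B \<omega> \<le> hitting_time (space M - A) \<omega> \<and> hitting_time B \<omega> < \<infinity>}"

definition invariance ::
    "'a measure \<Rightarrow> ('a \<Rightarrow> 'a measure) \<Rightarrow> nat \<Rightarrow> 'a set \<Rightarrow> 'a \<Rightarrow> real" where
  "invariance M P n A x =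
     measure (path_law M P x)
       {\<omega> \<in> space (path_law M P x). hitting_time (space M - A) \<omega> > enat n}"

definition contraction_index :: "'a measure \<Rightarrow> ('a \<Rightarrow> 'a measure) \<Rightarrow> 'a set \<Rightarrow> enat" where
  "contraction_index M P A = Inf (enat ` {m. sup_norm M (invariance M P m A) < 1})"


subsection \<open>Absorbing sets\<close>

definition absorbing :: "'a measure \<Rightarrow> ('a \<Rightarrow> 'a measure) \<Rightarrow> 'a set \<Rightarrow> bool" where
  "absorbing M P D \<longleftrightarrow> D \<in> sets M \<and> (\<forall>x\<in>D. measure (P x) D = 1)"

definition las :: "'a measure \<Rightarrow> ('a \<Rightarrow> 'a measure) \<Rightarrow> 'a set \<Rightarrow> 'a set" where
  "las M P A = (GREATEST D. absorbing M P D \<and> D \<subseteq> A)"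

definition simple_set :: "'a measure \<Rightarrow> ('a \<Rightarrow> 'a measure) \<Rightarrow> 'a set \<Rightarrow> bool" where
  "simple_set M P A \<longleftrightarrow> las M P A = {}"

lemma las_greatest:
  assumes "markov_process M P" and A: "A \<in> sets M"
  shows "absorbing M P (las M P A)" and "las M P A \<subseteq> A"
    and "\<And>D. absorbing M P D \<Longrightarrow> D \<subseteq> A \<Longrightarrow> D \<subseteq> las M P A"
proof -
  have P: "P \<in> M \<rightarrow>\<^sub>M prob_algebra M"
    using assms by (simp add: markov_process_def)
  have sets_P: "sets (P x) = sets M" and prob_P: "prob_space (P x)" if "x \<in> space M" for x
    using measurable_space[OF P that] by (auto simp: space_prob_algebra)
  have meas: "(\<lambda>x. measure (P x) D) \<in> borel_measurable M" if "D \<in> sets M" for D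
    using measurable_compose[OF measurable_prob_algebraD[OF P]
        measurable_measure_subprob_algebra[OF that]] .
  define S where "S = rec_nat A (\<lambda>_ T. {x \<in> T. measure (P x) T = 1})"
  have S_0: "S 0 = A" and S_Suc: "\<And>n. S (Suc n) = {x \<in> S n. measure (P x) (S n) = 1}"
    by (auto simp: S_def)
  have S_sets: "S n \<in> sets M" for n
  proof (induction n)
    case (Suc n)
    have "{x \<in> space M. measure (P x) (S n) = 1} \<in> sets M"
      using meas[OF Suc] by measurable
    moreover have "S (Suc n) = S n \<inter> {x \<in> space M. measure (P x) (S n) = 1}"
      using sets.sets_into_space[OF Suc] by (auto simp: S_Suc)
    ultimately show ?case
      using Suc by auto
  qed (simp add: S_0 A)
  define L where "L = (\<Inter>n. S n)"
  have L_sets: "L \<in> sets M"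
    unfolding L_def using S_sets by auto
  have "L \<subseteq> A"
    using S_0 by (auto simp: L_def)
  have "measure (P x) L = 1" if "x \<in> L" for x
  proof -
    have xM: "x \<in> space M"
      using that L_sets sets.sets_into_space by blast
    interpret prob_space "P x"
      using prob_P[OF xM] .
    have "AE y in P x. y \<in> S n" for n
    proof -
      have "x \<in> S (Suc n)"
        using that by (auto simp: L_def)
      then have "prob (S n) = 1"
        by (simp add: S_Suc)
      then show ?thesis
        using S_sets by (subst (asm) prob_eq_1) (auto simp: sets_P[OF xM])
    qed
    then have "AE y in P x. \<forall>n. y \<in> S n"
      by (simp add: AE_all_countable)
    then show ?thesis
      using L_sets by (subst prob_eq_1) (auto simp: sets_P[OF xM] L_def)
  qed
  then have "absorbing M P L"
    using L_sets by (simp add: absorbing_def)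
  have max: "D \<subseteq> L" if D: "absorbing M P D" "D \<subseteq> A" for D
  proof -
    have "D \<subseteq> S n" for n
    proof (induction n)
      case (Suc n)
      have "measure (P x) (S n) = 1" if "x \<in> D" for x
      proof -
        have xM: "x \<in> space M"
          using D that sets.sets_into_space by (auto simp: absorbing_def)
        interpret prob_space "P x"
          using prob_P[OF xM] .
        have "1 = prob D"
          using D that by (simp add: absorbing_def)
        also have "\<dots> \<le> prob (S n)"
          using Suc S_sets by (intro finite_measure_mono) (auto simp: sets_P[OF xM])
        finally show ?thesis
          using prob_le_1[of "S n"] by simp
      qed
      then show ?case
        using Suc by (auto simp: S_Suc)
    qed (simp add: S_0 D)
    then show ?thesis
      by (auto simp: L_def)
  qed
  have "las M P A = L"
    unfolding las_def
    using \<open>absorbing M P L\<close> \<open>L \<subseteq> A\<close> max by (intro Greatest_equality) auto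
  then show "absorbing M P (las M P A)" "las M P A \<subseteq> A"
    "\<And>D. absorbing M P D \<Longrightarrow> D \<subseteq> A \<Longrightarrow> D \<subseteq> las M P A"
    using \<open>absorbing M P L\<close> \<open>L \<subseteq> A\<close> max by auto
qed


subsection \<open>Locally excessive functions\<close>

definition excessive_set :: "'a measure \<Rightarrow> ('a \<Rightarrow> 'a measure) \<Rightarrow> ('a \<Rightarrow> real) \<Rightarrow> 'a set" where
  "excessive_set M P g = {x \<in> space M. kernel_op P g x - g x \<le> 0}"

definition locally_excessive ::
    "'a::topological_space measure \<Rightarrow> ('a \<Rightarrow> 'a measure) \<Rightarrow> real \<Rightarrow> 'a set \<Rightarrow> ('a \<Rightarrow> real) \<Rightarrow> bool"
where
  "locally_excessive M P \<delta> A g \<longleftrightarrow>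
     0 < \<delta> \<and>
     bounded_measurable M g \<and>
     continuous_on (space M) g \<and>
     (\<forall>x\<in>space M. 0 \<le> g x) \<and>
     {x \<in> space M. g x = 0} = las M P A \<and>
     {x \<in> space M. g x < \<delta>} \<subseteq> A \<and>
     {x \<in> space M. g x < \<delta>} \<subseteq> excessive_set M P g"

end

theory Submission
  imports Defs
begin

text \<open>
  The \<open>n\<close>-step value functions are iterates of the operator \<open>f \<mapsto> 1\<^sub>A P f\<close>, so everything
  follows by induction on the horizon.  Let \<open>K = A - {g < \<epsilon>\<delta>}\<close>, a compact simple set.

  If \<open>m(K)\<close> were infinite, the upper semicontinuous functions \<open>u\<^sub>n(\<cdot>;K)\<close> would all attain the
  value 1 on \<open>K\<close>, by compactness at a common point; but the points where every \<open>u\<^sub>n\<close> is 1 form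
  an absorbing subset of \<open>K\<close>.

  A path counted by \<open>w(x;A,B)\<close> but not by \<open>w(x;K,B)\<close> visits \<open>{g < \<epsilon>\<delta>}\<close> before reaching
  \<open>B \<subseteq> {g \<ge> \<delta>}\<close>, which by the supermartingale inequality has probability at most \<open>\<epsilon>\<close>.
\<close>

section \<open>Killed kernel and hitting times\<close>

text \<open>The kernel killed outside \<open>A\<close>. Extended non-negative values let it be
  iterated on measurable functions with no integrability condition.\<close>

definition step_op :: "('a \<Rightarrow> 'a measure) \<Rightarrow> 'a set \<Rightarrow> ('a \<Rightarrow> ennreal) \<Rightarrow> 'a \<Rightarrow> ennreal" where
  "step_op P A f x = indicator A x * (\<integral>\<^sup>+y. f y \<partial>P x)"

text \<open>Both value functions come from this: \<open>D = A\<close> gives the invariance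
  functions, \<open>D = B\<close> the summands of the reach-avoid function.\<close>

definition hit_prob ::
    "'a measure \<Rightarrow> ('a \<Rightarrow> 'a measure) \<Rightarrow> 'a set \<Rightarrow> 'a set \<Rightarrow> nat \<Rightarrow> 'a \<Rightarrow> real" where
  "hit_prob M P A D n x =
     measure (path_law M P x) {\<omega> \<in> space (path_law M P x). (\<forall>i<n. \<omega> i \<in> A) \<and> \<omega> n \<in> D}"

lemma hitting_time_greater_iff: "enat n < hitting_time D \<omega> \<longleftrightarrow> (\<forall>i\<le>n. \<omega> i \<notin> D)"
proof
  assume "enat n < hitting_time D \<omega>"
  moreover have "hitting_time D \<omega> \<le> enat i" if "\<omega> i \<in> D" for i
    unfolding hitting_time_def using that by (intro Inf_lower) auto
  ultimately show "\<forall>i\<le>n. \<omega> i \<notin> D"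
    by (meson enat_ord_simps(1) leD order_trans)
next
  assume *: "\<forall>i\<le>n. \<omega> i \<notin> D"
  \<comment> \<open>An infimum inherits only weak lower bounds, so strictness is obtained by aiming
    at \<open>Suc n\<close>. This also covers the empty infimum, which is infinite.\<close>
  have "enat (Suc n) \<le> hitting_time D \<omega>"
    unfolding hitting_time_def
    by (intro Inf_greatest) (use * in \<open>auto simp: not_less_eq_eq[symmetric]\<close>)
  then show "enat n < hitting_time D \<omega>"
    by (meson enat_ord_simps(2) lessI less_le_trans)
qed

section \<open>Measurability of the kernel and of its killed version\<close>

locale markov =
  fixes M :: "'a measure" and P :: "'a \<Rightarrow> 'a measure"
  assumes markov_process: "markov_process M P"
begin

lemma measurable_P: "P \<in> M \<rightarrow>\<^sub>M prob_algebra M"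
  using markov_process by (simp add: markov_process_def)

lemma measurable_P_subprob [measurable]: "P \<in> M \<rightarrow>\<^sub>M subprob_algebra M"
  using measurable_P by (rule measurable_prob_algebraD)

lemma prob_space_P: "x \<in> space M \<Longrightarrow> prob_space (P x)"
  using measurable_space[OF measurable_P] by (auto simp: space_prob_algebra)

lemma sets_P: "x \<in> space M \<Longrightarrow> sets (P x) = sets M"
  using measurable_space[OF measurable_P] by (auto simp: space_prob_algebra)

lemma space_P: "x \<in> space M \<Longrightarrow> space (P x) = space M"
  by (rule sets_eq_imp_space_eq) (rule sets_P)

lemma measurable_step_op [measurable]:
  assumes [measurable]: "A \<in> sets M" "f \<in> borel_measurable M"
  shows "step_op P A f \<in> borel_measurable M"
proof -
  have "(\<lambda>x. \<integral>\<^sup>+y. f y \<partial>P x) \<in> borel_measurable M"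
    using measurable_compose[OF measurable_P_subprob
        nn_integral_measurable_subprob_algebra[of f M]] by simp
  then show ?thesis
    unfolding step_op_def[abs_def] by simp
qed

lemma measurable_funpow_step_op:
  assumes "A \<in> sets M" "f \<in> borel_measurable M"
  shows "(step_op P A ^^ n) f \<in> borel_measurable M"
  by (induction n) (use assms in auto)

section \<open>The path law and its cylinder probabilities\<close>

lemma sets_path_law [measurable_cong]:
  assumes "x \<in> space M" shows "sets (path_law M P x) = sets (PiM UNIV (\<lambda>_. M))"
proof -
  interpret IT: Ionescu_Tulcea "transition M P x" "\<lambda>_. M"
    using markov_process assms by (rule Ionescu_Tulcea_transition)
  show ?thesis
    unfolding path_law_def by simp
qed

lemma space_path_law:
  "x \<in> space M \<Longrightarrow> space (path_law M P x) = space (PiM UNIV (\<lambda>_. M))"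
  by (rule sets_eq_imp_space_eq) (rule sets_path_law)

lemma prob_space_path_law:
  assumes "x \<in> space M" shows "prob_space (path_law M P x)"
proof -
  interpret IT: Ionescu_Tulcea "transition M P x" "\<lambda>_. M"
    using markov_process assms by (rule Ionescu_Tulcea_transition)
  \<comment> \<open>Projecting to no coordinates keeps the total mass, so a probability measure as
    image forces one as source.\<close>
  have "prob_space (distr IT.PF.lim (PiM {} (\<lambda>_. M)) (\<lambda>\<omega>. restrict \<omega> {}))"
    by (subst IT.distr_lim) (auto intro: IT.PF.prob_space_P)
  then show ?thesis
    unfolding path_law_def
    by (rule prob_space_distrD[rotated]) (auto intro!: measurable_restrict)
qed

text \<open>Integrating out the last coordinate replaces \<open>f\<close> by
  \<open>step_op P A f\<close> and shortens the cylinder by one, which is why the induction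
  generalizes over \<open>f\<close>. Coordinate 0 is drawn as well, from \<open>return M x\<close>,
  so reaching coordinate \<open>n\<close> takes \<open>Suc n\<close> kernels.\<close>

lemma nn_integral_cylinder:
  assumes x: "x \<in> space M" and A [measurable]: "A \<in> sets M"
    and f: "f \<in> borel_measurable M"
  shows "(\<integral>\<^sup>+\<omega>. indicator {\<omega>. \<forall>i<n. \<omega> i \<in> A} \<omega> * f (\<omega> n)
      \<partial>Ionescu_Tulcea.C (transition M P x) (\<lambda>_. M) 0 (Suc n) (\<lambda>_. undefined)) =
    (step_op P A ^^ n) f x"
proof -
  interpret IT: Ionescu_Tulcea "transition M P x" "\<lambda>_. M"
    using markov_process x by (rule Ionescu_Tulcea_transition)
  have meas: "(\<lambda>\<omega>. indicator {\<omega>. \<forall>i<n. \<omega> i \<in> A} \<omega> * f (\<omega> n))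
      \<in> borel_measurable (PiM {0..<Suc n} (\<lambda>_. M))" if [measurable]: "f \<in> borel_measurable M"
    for f :: "'a \<Rightarrow> ennreal" and n
  proof -
    have "Measurable.pred (PiM {0..<Suc n} (\<lambda>_. M)) (\<lambda>\<omega>. \<forall>i<n. \<omega> i \<in> A)"
    proof -
      have "Measurable.pred (PiM {0..<Suc n} (\<lambda>_. M)) (\<lambda>\<omega>. \<omega> i \<in> A)" if "i < n" for i
      proof -
        have [measurable]: "(\<lambda>\<omega>. \<omega> i) \<in> PiM {0..<Suc n} (\<lambda>_. M) \<rightarrow>\<^sub>M M"
          using that by (intro measurable_component_singleton) auto
        show ?thesis
          by measurable
      qed
      then have "Measurable.pred (PiM {0..<Suc n} (\<lambda>_. M)) (\<lambda>\<omega>. \<forall>i\<in>{..<n}. \<omega> i \<in> A)"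
        by (intro pred_intros_finite) auto
      then show ?thesis
        by (simp add: Ball_def)
    qed
    then have [measurable]: "(\<lambda>\<omega>. indicator {\<omega>. \<forall>i<n. \<omega> i \<in> A} \<omega> :: ennreal)
        \<in> borel_measurable (PiM {0..<Suc n} (\<lambda>_. M))"
      by (simp add: indicator_def)
    show ?thesis
      by measurable
  qed
  have undef: "(\<lambda>_::nat. undefined) \<in> space (PiM {0..<0} (\<lambda>_. M))"
    by (simp add: space_PiM)
  \<comment> \<open>The composition of kernels is a bind whose last kernel \<open>IT.eP n\<close>
    appends coordinate \<open>n\<close>; that kernel is split off here.\<close>
  have C_Suc: "(\<integral>\<^sup>+\<omega>. h \<omega> \<partial>IT.C 0 (Suc n) (\<lambda>_. undefined)) =
      (\<integral>\<^sup>+\<omega>. (\<integral>\<^sup>+y. h (fun_upd \<omega> n y) \<partial>transition M P x n \<omega>) \<partial>IT.C 0 n (\<lambda>_. undefined))"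
    if h: "h \<in> borel_measurable (PiM {0..<Suc n} (\<lambda>_. M))" for n h
  proof -
    have eP: "IT.eP n \<in> IT.C 0 n (\<lambda>_. undefined) \<rightarrow>\<^sub>M
        subprob_algebra (PiM {0..<Suc n} (\<lambda>_. M))"
      by (subst measurable_cong_sets[OF IT.sets_C[OF undef, of n, unfolded add_0] refl])
        (rule IT.measurable_eP)
    have "(\<integral>\<^sup>+\<omega>. h \<omega> \<partial>IT.C 0 (Suc n) (\<lambda>_. undefined)) =
        (\<integral>\<^sup>+\<omega>. (\<integral>\<^sup>+\<omega>'. h \<omega>' \<partial>IT.eP n \<omega>) \<partial>IT.C 0 n (\<lambda>_. undefined))"
      using h eP by (simp, subst nn_integral_bind[where B="PiM {0..<Suc n} (\<lambda>_. M)"]) auto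
    also have "\<dots> = (\<integral>\<^sup>+\<omega>. (\<integral>\<^sup>+y. h (fun_upd \<omega> n y) \<partial>transition M P x n \<omega>) \<partial>IT.C 0 n (\<lambda>_. undefined))"
      using h by (intro nn_integral_cong IT.nn_integral_eP) (auto simp: IT.space_C[OF undef])
    finally show ?thesis .
  qed
  show ?thesis
    using f
  proof (induction n arbitrary: f)
    case 0
    then show ?case
      using x undef
      by (subst C_Suc[OF meas]) (auto simp: transition_def nn_integral_return)
  next
    case (Suc n)
    have [measurable]: "f \<in> borel_measurable M"
      by fact
    have "(\<integral>\<^sup>+y. indicator {\<omega>. \<forall>i<Suc n. \<omega> i \<in> A} (fun_upd \<omega> (Suc n) y) * f (fun_upd \<omega> (Suc n) y (Suc n))
          \<partial>transition M P x (Suc n) \<omega>) =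
        indicator {\<omega>. \<forall>i<n. \<omega> i \<in> A} \<omega> * step_op P A f (\<omega> n)"
      if "\<omega> \<in> space (PiM {0..<Suc n} (\<lambda>_. M))" for \<omega>
    proof -
      have "\<omega> n \<in> space M"
        using that by (auto simp: space_PiM)
      then have meas_f: "f \<in> borel_measurable (P (\<omega> n))"
        by (simp add: measurable_cong_sets[OF sets_P])
      have "indicator {\<omega>. \<forall>i<Suc n. \<omega> i \<in> A} (fun_upd \<omega> (Suc n) y) =
          indicator {\<omega>. \<forall>i<n. \<omega> i \<in> A} \<omega> * (indicator A (\<omega> n) :: ennreal)" for y
        by (auto simp: indicator_def less_Suc_eq)
      then show ?thesis
        using meas_f by (simp add: transition_def step_op_def nn_integral_cmult mult.assoc)
    qed
    then have "(\<integral>\<^sup>+\<omega>. indicator {\<omega>. \<forall>i<Suc n. \<omega> i \<in> A} \<omega> * f (\<omega> (Suc n))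
          \<partial>IT.C 0 (Suc (Suc n)) (\<lambda>_. undefined)) =
        (\<integral>\<^sup>+\<omega>. indicator {\<omega>. \<forall>i<n. \<omega> i \<in> A} \<omega> * step_op P A f (\<omega> n)
          \<partial>IT.C 0 (Suc n) (\<lambda>_. undefined))"
      using Suc.prems
      by (subst C_Suc[OF meas]) (auto simp: IT.space_C[OF undef] simp del: IT.C.simps intro!: nn_integral_cong)
    also have "\<dots> = (step_op P A ^^ Suc n) f x"
      \<comment> \<open>The induction hypothesis is used at \<open>step_op P A f\<close>;
        \<open>funpow_swap1\<close> reconciles this innermost application with the outermost
        one.\<close>
      by (subst Suc.IH) (auto simp: funpow_swap1)
    finally show ?case .
  qed
qed

lemma hit_event_sets:
  assumes x: "x \<in> space M" and [measurable]: "A \<in> sets M" "D \<in> sets M"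
  shows "{\<omega> \<in> space (path_law M P x). (\<forall>i<n. \<omega> i \<in> A) \<and> \<omega> n \<in> D} \<in> sets (path_law M P x)"
  using sets_path_law[OF x, measurable_cong] by measurable

text \<open>The event depends only on the coordinates up to \<open>n\<close>, so the projective
  limit gives it the mass of a finite composition of kernels, which
  \<open>nn_integral_cylinder\<close> evaluates.\<close>

lemma emeasure_hit_event:
  assumes x: "x \<in> space M" and A [measurable]: "A \<in> sets M" and D [measurable]: "D \<in> sets M"
  shows "emeasure (path_law M P x)
      {\<omega> \<in> space (path_law M P x). (\<forall>i<n. \<omega> i \<in> A) \<and> \<omega> n \<in> D} =
    (step_op P A ^^ n) (indicator D) x"
proof -
  interpret IT: Ionescu_Tulcea "transition M P x" "\<lambda>_. M"
    using markov_process x by (rule Ionescu_Tulcea_transition)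
  let ?S = "PiM {0..<Suc n} (\<lambda>_. M)"
  let ?C = "IT.C 0 (Suc n) (\<lambda>_. undefined)"
  let ?X = "{\<omega> \<in> space ?S. (\<forall>i<n. \<omega> i \<in> A) \<and> \<omega> n \<in> D}"
  have undef: "(\<lambda>_::nat. undefined) \<in> space (PiM {0..<0} (\<lambda>_. M))"
    by (simp add: space_PiM)
  have eq: "?X = (\<Inter>i\<in>{..<n}. {\<omega> \<in> space ?S. \<omega> i \<in> A}) \<inter> {\<omega> \<in> space ?S. \<omega> n \<in> D}"
    by auto
  have "{\<omega> \<in> space ?S. \<omega> i \<in> E} \<in> sets ?S" if [measurable]: "E \<in> sets M" and "i \<le> n" for i E
  proof -
    have [measurable]: "(\<lambda>\<omega>. \<omega> i) \<in> ?S \<rightarrow>\<^sub>M M"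
      using that by (intro measurable_component_singleton) auto
    show ?thesis
      by measurable
  qed
  \<comment> \<open>An intersection over no indices is the whole type, hence the separate case
    \<open>n = 0\<close>.\<close>
  then have X: "?X \<in> sets ?S"
    by (cases "n = 0") (auto simp: eq intro!: sets.Int sets.finite_INT)
  have "{\<omega> \<in> space (path_law M P x). (\<forall>i<n. \<omega> i \<in> A) \<and> \<omega> n \<in> D} =
      IT.PF.emb UNIV {0..<Suc n} ?X"
    using space_path_law[OF x] by (auto simp: prod_emb_def space_PiM)
  then have "emeasure (path_law M P x)
      {\<omega> \<in> space (path_law M P x). (\<forall>i<n. \<omega> i \<in> A) \<and> \<omega> n \<in> D} = IT.CI {0..<Suc n} ?X"
    using X by (simp add: path_law_def IT.lim del: atLeastLessThanSuc)
  also have "\<dots> = emeasure ?C ?X"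
    using X sets.sets_into_space[OF X]
    by (subst IT.emeasure_CI[of _ "Suc n"]) (auto simp del: IT.C.simps simp: prod_emb_id space_PiM)
  also have "\<dots> = (\<integral>\<^sup>+\<omega>. indicator ?X \<omega> \<partial>?C)"
    using X by (intro nn_integral_indicator[symmetric]) (simp only: IT.sets_C[OF undef] add_0)
  also have "\<dots> = (\<integral>\<^sup>+\<omega>. indicator {\<omega>. \<forall>i<n. \<omega> i \<in> A} \<omega> * indicator D (\<omega> n) \<partial>?C)"
    by (intro nn_integral_cong)
      (simp only: IT.space_C[OF undef] add_0, simp add: indicator_def)
  also have "\<dots> = (step_op P A ^^ n) (indicator D) x"
    by (rule nn_integral_cylinder) (use x in auto)
  finally show ?thesis .
qed

section \<open>Real-valued hitting probabilities and their recursion\<close>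

lemma hit_prob_nonneg: "0 \<le> hit_prob M P A D n x"
  by (simp add: hit_prob_def)

lemma hit_prob_le_1: "x \<in> space M \<Longrightarrow> hit_prob M P A D n x \<le> 1"
  unfolding hit_prob_def by (intro prob_space.prob_le_1 prob_space_path_law)

lemma ennreal_hit_prob:
  assumes x: "x \<in> space M" and AD: "A \<in> sets M" "D \<in> sets M"
  shows "ennreal (hit_prob M P A D n x) = (step_op P A ^^ n) (indicator D) x"
proof -
  interpret prob_space "path_law M P x"
    using x by (rule prob_space_path_law)
  show ?thesis
    unfolding hit_prob_def by (simp add: emeasure_eq_measure[symmetric] emeasure_hit_event[OF x AD])
qed

lemma hit_prob_0:
  assumes x: "x \<in> space M" and AD: "A \<in> sets M" "D \<in> sets M"
  shows "hit_prob M P A D 0 x = indicator D x"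
proof -
  have "ennreal (hit_prob M P A D 0 x) = ennreal (indicator D x)"
    using ennreal_hit_prob[OF assms, of 0] by (simp add: indicator_def)
  then show ?thesis
    by (subst (asm) ennreal_inj) (auto simp: hit_prob_nonneg)
qed

lemma measurable_hit_prob [measurable]:
  assumes AD: "A \<in> sets M" "D \<in> sets M"
  shows "hit_prob M P A D n \<in> borel_measurable M"
proof -
  have "(\<lambda>x. enn2real ((step_op P A ^^ n) (indicator D) x)) \<in> borel_measurable M"
    using measurable_funpow_step_op[OF AD(1), of "indicator D" n] AD by simp
  then show ?thesis
    by (rule measurable_cong[THEN iffD1, rotated])
      (simp add: ennreal_hit_prob[OF _ AD, symmetric] hit_prob_nonneg)
qed

lemma integrable_P:
  assumes x: "x \<in> space M" and f: "f \<in> borel_measurable M"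
    and bound: "\<And>y. y \<in> space M \<Longrightarrow> \<bar>f y\<bar> \<le> (c :: real)"
  shows "integrable (P x) f"
proof -
  interpret prob_space "P x"
    using x by (rule prob_space_P)
  show ?thesis
    by (rule integrable_const_bound[where B = c])
      (use assms in \<open>auto simp: space_P measurable_cong_sets[OF sets_P]\<close>)
qed

lemma integrable_hit_prob:
  assumes "x \<in> space M" "A \<in> sets M" "D \<in> sets M"
  shows "integrable (P x) (hit_prob M P A D n)"
  by (rule integrable_P[where c = 1]) (use assms in \<open>auto simp: hit_prob_nonneg hit_prob_le_1\<close>)

text \<open>First-step analysis: the outermost factor of the iterate is split off. The integrands
  lie between 0 and 1, so the extended integral is an ordinary one.\<close>

lemma hit_prob_Suc:
  assumes x: "x \<in> space M" and AD: "A \<in> sets M" "D \<in> sets M"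
  shows "hit_prob M P A D (Suc n) x = indicator A x * kernel_op P (hit_prob M P A D n) x"
proof -
  have "ennreal (hit_prob M P A D (Suc n) x) =
      indicator A x * (\<integral>\<^sup>+y. (step_op P A ^^ n) (indicator D) y \<partial>P x)"
    by (simp add: ennreal_hit_prob[OF assms] step_op_def)
  also have "(\<integral>\<^sup>+y. (step_op P A ^^ n) (indicator D) y \<partial>P x) =
      (\<integral>\<^sup>+y. ennreal (hit_prob M P A D n y) \<partial>P x)"
    by (intro nn_integral_cong) (simp add: space_P x ennreal_hit_prob AD)
  also have "\<dots> = ennreal (kernel_op P (hit_prob M P A D n) x)"
    unfolding kernel_op_def
    by (intro nn_integral_eq_integral integrable_hit_prob assms) (simp add: hit_prob_nonneg)
  also have "indicator A x * \<dots> = ennreal (indicator A x * kernel_op P (hit_prob M P A D n) x)"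
    by (auto simp: indicator_def)
  finally show ?thesis
    by (subst (asm) ennreal_inj)
      (auto simp: hit_prob_nonneg kernel_op_def intro!: mult_nonneg_nonneg integral_nonneg_AE)
qed

lemma hit_prob_mono:
  assumes x: "x \<in> space M" and "A \<in> sets M" "D \<in> sets M" "A' \<subseteq> A"
  shows "hit_prob M P A' D n x \<le> hit_prob M P A D n x"
proof -
  interpret prob_space "path_law M P x"
    using x by (rule prob_space_path_law)
  show ?thesis
    unfolding hit_prob_def
    by (intro finite_measure_mono hit_event_sets) (use assms in auto)
qed

section \<open>Value functions through hitting probabilities\<close>

lemma invariance_eq_hit_prob:
  assumes x: "x \<in> space M"
  shows "invariance M P n A x = hit_prob M P A A n x"
proof -
  have "{\<omega> \<in> space (path_law M P x). enat n < hitting_time (space M - A) \<omega>} =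
      {\<omega> \<in> space (path_law M P x). (\<forall>i<n. \<omega> i \<in> A) \<and> \<omega> n \<in> A}"
    by (auto simp: hitting_time_greater_iff space_path_law[OF x] space_PiM le_less)
  then show ?thesis
    by (simp add: invariance_def hit_prob_def)
qed

text \<open>The event is split by the time at which \<open>B\<close> is reached. Disjointness of
  \<open>A\<close> and \<open>B\<close> makes this time unique, since a path that has stayed in
  \<open>A\<close> has not yet met \<open>B\<close>.\<close>

lemma reach_avoid_sums:
  assumes x: "x \<in> space M" and A: "A \<in> sets M" and B: "B \<in> sets M" and disj: "A \<inter> B = {}"
  shows "(\<lambda>n. hit_prob M P A B n x) sums reach_avoid M P x A B"
proof -
  interpret prob_space "path_law M P x"
    using x by (rule prob_space_path_law)
  let ?E = "\<lambda>n. {\<omega> \<in> space (path_law M P x). (\<forall>i<n. \<omega> i \<in> A) \<and> \<omega> n \<in> B}"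
  have eq: "{\<omega> \<in> space (path_law M P x).
        hitting_time B \<omega> \<le> hitting_time (space M - A) \<omega> \<and> hitting_time B \<omega> < \<infinity>} = (\<Union>n. ?E n)"
    (is "?L = ?R")
  proof (intro equalityI subsetI)
    fix \<omega> assume \<omega>: "\<omega> \<in> ?L"
    then obtain n where n: "hitting_time B \<omega> = enat n"
      by auto
    have sp: "\<omega> i \<in> space M" for i
      using \<omega> by (auto simp: space_path_law[OF x] space_PiM)
    have "\<omega> i \<in> A" if "i < n" for i
    proof -
      have "enat i < hitting_time (space M - A) \<omega>"
        using that \<omega> n by (auto intro: less_le_trans[of _ "enat n"])
      then show ?thesis
        using sp by (auto simp: hitting_time_greater_iff)
    qed
    moreover have "\<omega> n \<in> B"
    proof (rule ccontr)
      assume "\<omega> n \<notin> B"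
      moreover have "\<omega> i \<notin> B" if "i < n" for i
        using hitting_time_greater_iff[of i B \<omega>] that n by auto
      ultimately have "enat n < hitting_time B \<omega>"
        by (auto simp: hitting_time_greater_iff le_less)
      then show False
        using n by simp
    qed
    ultimately show "\<omega> \<in> ?R"
      using \<omega> by auto
  next
    fix \<omega> assume "\<omega> \<in> ?R"
    then obtain n where \<omega>: "\<omega> \<in> space (path_law M P x)" "\<forall>i<n. \<omega> i \<in> A" "\<omega> n \<in> B"
      by auto
    have "hitting_time B \<omega> \<le> enat n"
      using \<omega> hitting_time_greater_iff[of n B \<omega>] by (auto simp: not_less[symmetric])
    moreover have "enat n \<le> hitting_time (space M - A) \<omega>"
      unfolding hitting_time_def
      by (intro Inf_greatest) (use \<omega> in \<open>auto simp: not_less[symmetric]\<close>)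
    moreover have "hitting_time B \<omega> < \<infinity>"
      using \<open>hitting_time B \<omega> \<le> enat n\<close> by (rule le_less_trans) simp
    ultimately show "\<omega> \<in> ?L"
      using \<omega>(1) by (auto intro: order_trans)
  qed
  have "disjoint_family ?E"
    unfolding disjoint_family_on_def
  proof (intro ballI impI)
    fix m n :: nat assume "m \<noteq> n"
    have disj_less: "?E m \<inter> ?E n = {}" if "m < n" for m n
      using disj that by blast
    show "?E m \<inter> ?E n = {}"
    proof (cases "m < n")
      case True
      then show ?thesis
        by (rule disj_less)
    next
      case False
      with \<open>m \<noteq> n\<close> have "n < m"
        by simp
      then show ?thesis
        by (subst Int_commute) (rule disj_less)
    qed
  qed
  moreover have "range ?E \<subseteq> events"
    by (intro image_subsetI hit_event_sets x A B)
  ultimately show ?thesis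
    unfolding reach_avoid_def hit_prob_def eq by (intro finite_measure_UNION)
qed

lemma invariance_0:
  "x \<in> space M \<Longrightarrow> A \<in> sets M \<Longrightarrow> invariance M P 0 A x = indicator A x"
  by (simp add: invariance_eq_hit_prob hit_prob_0)

lemma kernel_op_cong:
  assumes "x \<in> space M" "\<And>y. y \<in> space M \<Longrightarrow> f y = h y"
  shows "kernel_op P f x = kernel_op P h x"
  unfolding kernel_op_def by (intro Bochner_Integration.integral_cong) (use assms in \<open>auto simp: space_P\<close>)

lemma invariance_Suc:
  assumes "x \<in> space M" "A \<in> sets M"
  shows "invariance M P (Suc n) A x = indicator A x * kernel_op P (invariance M P n A) x"
  using assms kernel_op_cong[of x "invariance M P n A" "hit_prob M P A A n"]
  by (simp add: invariance_eq_hit_prob hit_prob_Suc)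

lemma invariance_nonneg: "0 \<le> invariance M P n A x"
  by (simp add: invariance_def)

lemma invariance_le_1: "x \<in> space M \<Longrightarrow> invariance M P n A x \<le> 1"
  by (simp add: invariance_eq_hit_prob hit_prob_le_1)

lemma measurable_invariance [measurable]:
  "A \<in> sets M \<Longrightarrow> invariance M P n A \<in> borel_measurable M"
  using measurable_hit_prob[of A A n]
  by (subst measurable_cong[OF invariance_eq_hit_prob])

lemma invariance_antimono:
  assumes x: "x \<in> space M" and A: "A \<in> sets M"
  shows "invariance M P (Suc n) A x \<le> invariance M P n A x"
proof -
  interpret prob_space "path_law M P x"
    using x by (rule prob_space_path_law)
  show ?thesis
    unfolding invariance_eq_hit_prob[OF x] hit_prob_def
    by (intro finite_measure_mono hit_event_sets x A) auto
qed

text \<open>If the invariance function of horizon \<open>Suc n\<close> is 1 at \<open>x\<close>,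
  then \<open>1 - invariance M P n A\<close> is non-negative with integral zero under
  \<open>P x\<close>, hence vanishes almost surely; countably many \<open>n\<close> share one null
  set.\<close>

lemma absorbing_invariance_eq_1:
  assumes A: "A \<in> sets M"
  shows "absorbing M P {x \<in> space M. \<forall>n. invariance M P n A x = 1}" (is "absorbing M P ?C")
  unfolding absorbing_def
proof (intro conjI ballI)
  show C: "?C \<in> sets M"
    using A by measurable
  fix x assume "x \<in> ?C"
  then have x: "x \<in> space M" and inv: "\<And>n. invariance M P n A x = 1"
    by auto
  interpret prob_space "P x"
    using x by (rule prob_space_P)
  have "AE y in P x. invariance M P n A y = 1" for n
  proof -
    let ?f = "\<lambda>y. 1 - invariance M P n A y"
    have int: "integrable (P x) (invariance M P n A)"
      by (rule integrable_P[where c = 1]) (use x A in \<open>auto simp: invariance_nonneg invariance_le_1\<close>)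
    have "kernel_op P (invariance M P n A) x = 1"
      using inv[of "Suc n"] by (cases "x \<in> A") (simp_all add: invariance_Suc[OF x A])
    then have "(\<integral>y. ?f y \<partial>P x) = 0"
      using int by (simp add: kernel_op_def prob_space)
    moreover have "AE y in P x. 0 \<le> ?f y"
      by (intro AE_I2) (simp add: space_P x invariance_le_1)
    ultimately have "AE y in P x. ?f y = 0"
      using int by (subst (asm) integral_nonneg_eq_0_iff_AE) auto
    then show ?thesis
      by auto
  qed
  then have "AE y in P x. \<forall>n. invariance M P n A y = 1"
    by (simp add: AE_all_countable)
  then have "AE y in P x. y \<in> ?C"
    by (rule AE_mp) (auto intro!: AE_I2 simp: space_P x)
  then show "measure (P x) ?C = 1"
    using C by (subst prob_eq_1) (auto simp: sets_P x)
qed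

section \<open>Finite-horizon estimates\<close>

text \<open>For disjoint \<open>A\<close> and \<open>B\<close> the partial sums are finite-horizon
  reach-avoid values, and this is their dynamic programming recursion. It drives the induction in
  both estimates below.\<close>

lemma sum_hit_prob_Suc:
  assumes x: "x \<in> space M" and AB: "A \<in> sets M" "B \<in> sets M"
  shows "(\<Sum>k<Suc n. hit_prob M P A B k x) =
    indicator B x + indicator A x * kernel_op P (\<lambda>y. \<Sum>k<n. hit_prob M P A B k y) x"
  using integrable_hit_prob[OF assms]
  by (cases "x \<in> A")
    (simp_all add: sum.lessThan_Suc_shift hit_prob_0[OF assms] hit_prob_Suc[OF assms] kernel_op_def
      Bochner_Integration.integral_sum del: sum.lessThan_Suc)

lemma integrable_sum_hit_prob:
  assumes "x \<in> space M" "A \<in> sets M" "B \<in> sets M"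
  shows "integrable (P x) (\<lambda>y. \<Sum>k<n. hit_prob M P A B k y)"
  using integrable_hit_prob[OF assms] by (intro Bochner_Integration.integrable_sum) auto

lemma sum_hit_prob_le_1:
  assumes "x \<in> space M" "A \<in> sets M" "B \<in> sets M" "A \<inter> B = {}"
  shows "(\<Sum>k<n. hit_prob M P A B k x) \<le> 1"
proof -
  interpret prob_space "path_law M P x"
    using assms(1) by (rule prob_space_path_law)
  have "(\<Sum>k<n. hit_prob M P A B k x) \<le> reach_avoid M P x A B"
    using reach_avoid_sums[OF assms]
    by (metis sum_le_suminf sums_iff finite_lessThan hit_prob_nonneg)
  also have "\<dots> \<le> 1"
    by (simp add: reach_avoid_def)
  finally show ?thesis .
qed

text \<open>Optional stopping for the nonnegative supermartingale \<open>g\<close>, at the exit from \<open>{g < \<delta>}\<close>.\<close>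

lemma sum_hit_prob_le_excessive:
  assumes x: "x \<in> space M" and AB: "A \<in> sets M" "B \<in> sets M" "A \<inter> B = {}"
    and g: "bounded_measurable M g" "\<And>y. y \<in> space M \<Longrightarrow> 0 \<le> g y" and \<delta>: "0 < \<delta>"
    and sub: "{y \<in> space M. g y < \<delta>} \<subseteq> A"
    and exc: "{y \<in> space M. g y < \<delta>} \<subseteq> excessive_set M P g"
  shows "(\<Sum>k<n. hit_prob M P A B k x) \<le> g x / \<delta>"
  using x
proof (induction n arbitrary: x)
  case 0
  then show ?case
    using g \<delta> by simp
next
  case (Suc n)
  show ?case
  proof (cases "g x < \<delta>")
    \<comment> \<open>At these points the right-hand side is at least 1, so the bound for
      probabilities suffices.\<close>
    case False
    then have "1 \<le> g x / \<delta>"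
      using \<delta> by simp
    then show ?thesis
      using sum_hit_prob_le_1[OF Suc.prems AB, of "Suc n"] by linarith
  next
    case True
    then have "x \<in> A"
      using sub Suc.prems by auto
    then have "x \<notin> B"
      using AB by auto
    obtain c where c: "\<And>y. y \<in> space M \<Longrightarrow> \<bar>g y\<bar> \<le> c"
      using g(1) by (auto simp: bounded_measurable_def bounded_iff)
    have "integrable (P x) g"
      using g(1) c by (intro integrable_P Suc.prems) (auto simp: bounded_measurable_def)
    \<comment> \<open>Inside \<open>{g < \<delta>}\<close> the indicator of \<open>B\<close> drops
      out; the induction hypothesis bounds the integrand, and excessiveness bounds the integral of
      \<open>g\<close>.\<close>
    have "(\<Sum>k<Suc n. hit_prob M P A B k x) = kernel_op P (\<lambda>y. \<Sum>k<n. hit_prob M P A B k y) x"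
      using \<open>x \<in> A\<close> \<open>x \<notin> B\<close> by (simp only: sum_hit_prob_Suc[OF Suc.prems AB(1,2)]) simp
    also have "\<dots> \<le> (\<integral>y. g y / \<delta> \<partial>P x)"
      unfolding kernel_op_def
      using \<open>integrable (P x) g\<close> Suc.prems Suc.IH AB
      by (intro integral_mono integrable_sum_hit_prob) (auto simp: space_P)
    also have "\<dots> = kernel_op P g x / \<delta>"
      by (simp add: kernel_op_def)
    also have "\<dots> \<le> g x / \<delta>"
      using exc True Suc.prems \<delta> by (auto simp: excessive_set_def intro!: divide_right_mono)
    finally show ?thesis .
  qed
qed

text \<open>The difference vanishes outside \<open>A\<close>, is the \<open>P x\<close>-average of
  the differences at the next state on \<open>A'\<close>, and on \<open>A - A'\<close> is at most
  the first sum. \<open>small\<close> ranges over all horizons because the time left on entering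
  \<open>A - A'\<close> varies.\<close>

lemma sum_hit_prob_diff_le:
  assumes x: "x \<in> space M" and AB: "A \<in> sets M" "A' \<in> sets M" "B \<in> sets M"
    and sub: "A' \<subseteq> A" and \<epsilon>: "0 \<le> \<epsilon>"
    and small: "\<And>n y. y \<in> A - A' \<Longrightarrow> (\<Sum>k<n. hit_prob M P A B k y) \<le> \<epsilon>"
  shows "(\<Sum>k<n. hit_prob M P A B k x) - (\<Sum>k<n. hit_prob M P A' B k x) \<le> \<epsilon>"
  using x
proof (induction n arbitrary: x)
  case 0
  then show ?case
    using \<epsilon> by simp
next
  case (Suc n)
  interpret P: prob_space "P x"
    using Suc.prems by (rule prob_space_P)
  let ?W = "\<lambda>y. \<Sum>k<n. hit_prob M P A B k y" and ?V = "\<lambda>y. \<Sum>k<n. hit_prob M P A' B k y"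
  consider "x \<notin> A" | "x \<in> A'" | "x \<in> A - A'"
    by auto
  then show ?case
  proof cases
    case 1
    with sub have "x \<notin> A'" by auto
    with 1 show ?thesis
      using \<epsilon> Suc.prems AB by (simp only: sum_hit_prob_Suc) simp
  next
    case 2
    with sub have "x \<in> A" by auto
    have "kernel_op P ?W x - kernel_op P ?V x = (\<integral>y. ?W y - ?V y \<partial>P x)"
      unfolding kernel_op_def
      by (intro Bochner_Integration.integral_diff[symmetric] integrable_sum_hit_prob Suc.prems AB)
    also have "\<dots> \<le> (\<integral>y. \<epsilon> \<partial>P x)"
      using Suc AB
      by (intro integral_mono Bochner_Integration.integrable_diff integrable_sum_hit_prob)
        (auto simp: space_P)
    also have "\<dots> = \<epsilon>"
      by (simp add: P.prob_space)
    finally show ?thesis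
      using 2 \<open>x \<in> A\<close> Suc.prems AB by (simp only: sum_hit_prob_Suc) simp
  next
    case 3
    moreover have "0 \<le> (\<Sum>k<Suc n. hit_prob M P A' B k x)"
      by (intro sum_nonneg) (simp add: hit_prob_nonneg)
    ultimately show ?thesis
      using small[of x "Suc n"] by linarith
  qed
qed

end

section \<open>Upper semicontinuity, compactness and the contraction index\<close>

text \<open>For a positive level the sublevel set is that of \<open>h\<close> enlarged by the open
  complement of \<open>K\<close>; for other levels it is empty, the product being
  non-negative.\<close>

lemma upper_semicontinuous_on_indicator_mult:
  assumes K: "closed K" and h: "upper_semicontinuous_on S h" "\<And>x. x \<in> S \<Longrightarrow> 0 \<le> h x"
  shows "upper_semicontinuous_on S (\<lambda>x. indicator K x * h x)"
  unfolding upper_semicontinuous_on_def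
proof
  fix c :: real
  show "openin (top_of_set S) {x \<in> S. indicator K x * h x < c}"
  proof (cases "0 < c")
    case True
    then have "{x \<in> S. indicator K x * h x < c} = (S \<inter> - K) \<union> {x \<in> S. h x < c}"
      by (auto simp: indicator_def)
    moreover have "openin (top_of_set S) (S \<inter> - K)"
      using K by (intro openin_open_Int) (auto simp: open_Compl)
    ultimately show ?thesis
      using h(1) by (auto simp: upper_semicontinuous_on_def intro: openin_Un)
  next
    case False
    then have "{x \<in> S. indicator K x * h x < c} = {}"
      using h(2) by (auto simp: not_less intro!: order_trans[of c 0] mult_nonneg_nonneg)
    then show ?thesis
      by (simp only: openin_empty)
  qed
qed

text \<open>Without a common point the relatively open sets \<open>{u n < c}\<close> with
  \<open>c < a\<close> cover \<open>K\<close>, and by monotonicity a finite subcover puts a single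
  \<open>u N\<close> below a single \<open>c < a\<close> on all of \<open>K\<close>. Levels below
  \<open>a\<close> are used because \<open>ex\<close> does not say that the value \<open>a\<close>
  is attained.\<close>

lemma upper_semicontinuous_decreasing_common_point:
  fixes K S :: "'a::topological_space set" and u :: "nat \<Rightarrow> 'a \<Rightarrow> real"
  assumes K: "compact K" "K \<subseteq> S"
    and usc: "\<And>n. upper_semicontinuous_on S (u n)"
    and dec: "\<And>n x. x \<in> K \<Longrightarrow> u (Suc n) x \<le> u n x"
    and ex: "\<And>n c. c < a \<Longrightarrow> \<exists>x\<in>K. c < u n x"
  shows "\<exists>x\<in>K. \<forall>n. a \<le> u n x"
proof (rule ccontr)
  assume no: "\<not> ?thesis"
  have "\<exists>T. open T \<and> {x \<in> S. u n x < c} = S \<inter> T" for n c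
    using usc[of n] by (auto simp: upper_semicontinuous_on_def openin_open)
  then obtain T where T: "\<And>n c. open (T n c)" "\<And>n c. {x \<in> S. u n x < c} = S \<inter> T n c"
    by metis
  let ?I = "{p :: nat \<times> real. snd p < a}"
  have T_iff: "x \<in> T n c \<longleftrightarrow> u n x < c" if "x \<in> K" for x n c
    using T(2)[of n c] that K(2) by blast
  have "K \<subseteq> (\<Union>p\<in>?I. T (fst p) (snd p))"
  proof
    fix x assume x: "x \<in> K"
    then obtain n where "u n x < a"
      using no by (auto simp: not_le)
    then obtain c where "u n x < c" "c < a"
      using dense by blast
    then show "x \<in> (\<Union>p\<in>?I. T (fst p) (snd p))"
      using x by (auto simp: T_iff intro!: exI[of _ n] exI[of _ c])
  qed
  then obtain F where F: "F \<subseteq> ?I" "finite F" "K \<subseteq> (\<Union>p\<in>F. T (fst p) (snd p))"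
    using compactE_image[OF K(1), of ?I "\<lambda>p. T (fst p) (snd p)"] T(1) by auto
  \<comment> \<open>The inserted 0 and \<open>a - 1\<close> keep both maxima defined when
    \<open>F\<close> is empty, and \<open>a - 1\<close> is below \<open>a\<close>.\<close>
  define N where "N = Max (insert 0 (fst ` F))"
  define c where "c = Max (insert (a - 1) (snd ` F))"
  have "c < a"
    using F by (auto simp: c_def)
  then obtain x where x: "x \<in> K" "c < u N x"
    using ex by blast
  then obtain p where p: "p \<in> F" "u (fst p) x < snd p"
    using F(3) T_iff by blast
  have "fst p \<le> N"
    unfolding N_def using F(2) p(1) by (intro Max_ge) auto
  then have "u N x \<le> u (fst p) x"
    by (rule lift_Suc_antimono_le[of "\<lambda>n. u n x", OF dec[OF x(1)]])
  also note p(2)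
  also have "snd p \<le> c"
    unfolding c_def using F(2) p(1) by (intro Max_ge) auto
  finally show False
    using x by simp
qed

text \<open>Weak continuity carries upper semicontinuity through the recursion of the invariance
  functions. The state space is taken non-empty because \<open>sup_norm\<close> is a supremum over
  it.\<close>

lemma contraction_index_finite:
  fixes M :: "'a::polish_space measure"
  assumes mp: "markov_process M P" and wc: "weakly_continuous M P"
    and K: "K \<in> sets M" "compact K" "simple_set M P K" and ne: "space M \<noteq> {}"
  shows "contraction_index M P K < \<infinity>"
proof -
  interpret markov M P
    using mp by unfold_locales
  have usc: "upper_semicontinuous_on (space M) (invariance M P n K)" for n
  proof (induction n)
    case 0
    have "openin (top_of_set (space M)) {x \<in> space M. (1::real) < c}" for c
      by (cases "1 < c") auto
    then have "upper_semicontinuous_on (space M) (\<lambda>x. indicator K x * 1)"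
      using K by (intro upper_semicontinuous_on_indicator_mult compact_imp_closed)
        (auto simp: upper_semicontinuous_on_def)
    then show ?case
      using K by (simp add: upper_semicontinuous_on_def invariance_0 cong: conj_cong)
  next
    case (Suc n)
    have "bounded_measurable M (invariance M P n K)"
      unfolding bounded_measurable_def bounded_iff
      using K invariance_nonneg invariance_le_1 by (auto intro!: exI[of _ 1])
    then have "upper_semicontinuous_on (space M) (kernel_op P (invariance M P n K))"
      using wc Suc by (auto simp: weakly_continuous_def)
    moreover have "0 \<le> kernel_op P (invariance M P n K) x" for x
      by (simp add: kernel_op_def invariance_nonneg)
    ultimately have "upper_semicontinuous_on (space M)
        (\<lambda>x. indicator K x * kernel_op P (invariance M P n K) x)"
      using K by (intro upper_semicontinuous_on_indicator_mult compact_imp_closed)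
    then show ?case
      using K by (simp add: upper_semicontinuous_on_def invariance_Suc cong: conj_cong)
  qed
  have "\<exists>m. sup_norm M (invariance M P m K) < 1"
  proof (rule ccontr)
    assume *: "\<not> ?thesis"
    \<comment> \<open>A sup norm that is not below 1 yields only values above every
      \<open>c < 1\<close>, which is what the compactness lemma asks for.\<close>
    have "\<exists>x\<in>K. c < invariance M P n K x" if "c < 1" for n c
    proof (rule ccontr)
      assume "\<not> ?thesis"
      then have le: "invariance M P n K x \<le> c" if "x \<in> K" for x
        using that by (auto simp: not_less)
      \<comment> \<open>Off \<open>K\<close> the invariance function is 0, so the uniform bound is
        \<open>max c 0\<close>, still below 1.\<close>
      have "\<bar>invariance M P n K x\<bar> \<le> max c 0" if "x \<in> space M" for x
      proof (cases "x \<in> K")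
        case True
        then show ?thesis
          using le[of x] by (simp add: invariance_nonneg)
      next
        case False
        then have "invariance M P n K x = 0"
          using that K by (cases n) (simp_all add: invariance_0 invariance_Suc)
        then show ?thesis
          by simp
      qed
      then have "sup_norm M (invariance M P n K) \<le> max c 0"
        unfolding sup_norm_def using ne by (intro cSUP_least)
      then show False
        using * that by (smt (verit))
    qed
    then obtain x where x: "x \<in> K" "\<And>n. 1 \<le> invariance M P n K x"
      using upper_semicontinuous_decreasing_common_point[of K "space M" "\<lambda>n. invariance M P n K" 1]
        K usc invariance_antimono sets.sets_into_space[OF K(1)] by (metis subsetD)
    \<comment> \<open>An absorbing set, contained in \<open>K\<close> by its condition at
      \<open>n = 0\<close>; the point \<open>x\<close> in it contradicts simplicity.\<close>
    let ?C = "{x \<in> space M. \<forall>n. invariance M P n K x = 1}"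
    have "?C \<subseteq> K"
      using K by (auto simp: invariance_0 indicator_def dest!: spec[of _ 0] split: if_splits)
    then have "?C \<subseteq> las M P K"
      using las_greatest(3)[OF mp K(1) absorbing_invariance_eq_1[OF K(1)]] by blast
    moreover have "x \<in> ?C"
      using x sets.sets_into_space[OF K(1)] by (auto intro!: antisym[OF invariance_le_1])
    ultimately show False
      using K(3) by (auto simp: simple_set_def)
  qed
  then obtain m where "sup_norm M (invariance M P m K) < 1" ..
  then have "contraction_index M P K \<le> enat m"
    unfolding contraction_index_def by (intro Inf_lower) auto
  then show ?thesis
    by (rule le_less_trans) simp
qed

section \<open>Removal of a sublevel set of the locally excessive function\<close>

theorem theorem2:
  fixes M :: "'a::polish_space measure" and P :: "'a \<Rightarrow> 'a measure"
    and A B :: "'a set" and g :: "'a \<Rightarrow> real" and \<delta> \<epsilon> :: real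
  assumes "markov_process M P" and "weakly_continuous M P"
    and "A \<in> sets M" and "B \<in> sets M" and "A \<inter> B = {}"
    and "compact A" and "\<not> simple_set M P A"
    and "locally_excessive M P \<delta> A g"
    and "0 < \<epsilon>" and "\<epsilon> < 1"
  shows "contraction_index M P (A - {x \<in> space M. g x < \<epsilon> * \<delta>}) < \<infinity> \<and>
    (\<forall>x\<in>space M.
       0 \<le> reach_avoid M P x A B
             - reach_avoid M P x (A - {x \<in> space M. g x < \<epsilon> * \<delta>}) B \<and>
       reach_avoid M P x A B
             - reach_avoid M P x (A - {x \<in> space M. g x < \<epsilon> * \<delta>}) B \<le> \<epsilon>)"
proof -
  interpret markov M P
    using assms(1) by unfold_locales
  define K where "K = A - {x \<in> space M. g x < \<epsilon> * \<delta>}"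
  have \<delta>: "0 < \<delta>" and g: "bounded_measurable M g" "continuous_on (space M) g"
      "\<And>x. x \<in> space M \<Longrightarrow> 0 \<le> g x"
    and zero: "{x \<in> space M. g x = 0} = las M P A"
    and sub: "{x \<in> space M. g x < \<delta>} \<subseteq> A"
    and exc: "{x \<in> space M. g x < \<delta>} \<subseteq> excessive_set M P g"
    using assms(8) by (auto simp: locally_excessive_def)
  have A_space: "A \<subseteq> space M"
    using assms(3) by (rule sets.sets_into_space)
  have [measurable]: "g \<in> borel_measurable M"
    using g by (simp add: bounded_measurable_def)
  have "{x \<in> space M. g x < \<epsilon> * \<delta>} \<in> sets M"
    by measurable
  then have K_sets: "K \<in> sets M"
    unfolding K_def using assms(3) by blast
  have "K \<subseteq> A"
    by (auto simp: K_def)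
  \<comment> \<open>As a preimage of a closed set under a function continuous on \<open>A\<close>,
    \<open>K\<close> is relatively closed in the compact set \<open>A\<close>.\<close>
  have "K = A \<inter> g -` {\<epsilon> * \<delta>..}"
    using A_space by (auto simp: K_def)
  moreover have "closedin (top_of_set A) (A \<inter> g -` {\<epsilon> * \<delta>..})"
    using continuous_on_subset[OF g(2) A_space] by (rule continuous_closedin_preimage) simp
  ultimately have "compact K"
    using closedin_compact[OF assms(6)] by simp
  have "simple_set M P K"
  proof -
    have "las M P K \<subseteq> las M P A"
      using las_greatest[OF assms(1) K_sets] las_greatest(3)[OF assms(1,3)] \<open>K \<subseteq> A\<close> by blast
    moreover have "las M P K \<subseteq> K"
      using las_greatest(2)[OF assms(1) K_sets] .
    \<comment> \<open>The largest absorbing subset of \<open>A\<close> is the zero set of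
      \<open>g\<close>, which \<open>K\<close> misses since \<open>\<epsilon> * \<delta>\<close> is
      positive.\<close>
    moreover have "las M P A \<inter> K = {}"
      using zero[symmetric] assms(9) \<delta> by (auto simp: K_def)
    ultimately show ?thesis
      by (auto simp: simple_set_def)
  qed
  \<comment> \<open>As \<open>A\<close> is non-simple, \<open>g\<close> has a zero in the state
    space.\<close>
  moreover have "space M \<noteq> {}"
    using assms(7) zero by (auto simp: simple_set_def)
  ultimately have "contraction_index M P K < \<infinity>"
    using contraction_index_finite[OF assms(1,2) K_sets \<open>compact K\<close>] by blast
  moreover have "0 \<le> reach_avoid M P x A B - reach_avoid M P x K B \<and>
      reach_avoid M P x A B - reach_avoid M P x K B \<le> \<epsilon>" if x: "x \<in> space M" for x
  proof -
    have A_sums: "(\<lambda>n. hit_prob M P A B n x) sums reach_avoid M P x A B"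
      using x assms(3-5) by (rule reach_avoid_sums)
    have K_sums: "(\<lambda>n. hit_prob M P K B n x) sums reach_avoid M P x K B"
      using assms(5) \<open>K \<subseteq> A\<close> by (intro reach_avoid_sums x K_sets assms(4)) auto
    have "reach_avoid M P x K B \<le> reach_avoid M P x A B"
      using hit_prob_mono[OF x assms(3,4) \<open>K \<subseteq> A\<close>] K_sums A_sums by (rule sums_le)
    \<comment> \<open>At a removed point \<open>g y < \<epsilon> * \<delta>\<close>, so the
      supermartingale bound \<open>g y / \<delta>\<close> is at most \<open>\<epsilon>\<close> at
      every horizon.\<close>
    moreover have small: "(\<Sum>k<n. hit_prob M P A B k y) \<le> \<epsilon>" if "y \<in> A - K" for n y
    proof -
      have "y \<in> space M" "g y < \<epsilon> * \<delta>"
        using that by (auto simp: K_def)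
      then have "(\<Sum>k<n. hit_prob M P A B k y) \<le> g y / \<delta>"
        using assms(3-5) g(1,3) \<delta> sub exc by (intro sum_hit_prob_le_excessive)
      also have "\<dots> \<le> \<epsilon>"
        using \<open>g y < \<epsilon> * \<delta>\<close> \<delta> by (simp add: pos_divide_le_eq)
      finally show ?thesis .
    qed
    \<comment> \<open>The error bound is uniform in the horizon and so survives the limit.\<close>
    have "(\<lambda>n. (\<Sum>k<n. hit_prob M P A B k x) - (\<Sum>k<n. hit_prob M P K B k x)) \<longlonglongrightarrow>
        reach_avoid M P x A B - reach_avoid M P x K B"
      using A_sums K_sums unfolding sums_def by (rule tendsto_diff)
    then have "reach_avoid M P x A B - reach_avoid M P x K B \<le> \<epsilon>"
      using sum_hit_prob_diff_le[OF x assms(3) K_sets assms(4) \<open>K \<subseteq> A\<close> _ small] assms(9)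
      by (intro LIMSEQ_le_const2) (auto intro!: exI[of _ 0])
    ultimately show ?thesis
      by simp
  qed
  ultimately show ?thesis
    by (simp add: K_def)
qed

end
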